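(* Let $K$ be a (small) differential subfield of $\mathcal{U}$, let $k$ be a differential subfield of $K$, and let $f_0,\dots,f_n\in K$. If $\mathbb{P}^n(\mathcal{U}^\Delta)$ is $k$-large with respect to $K$, then $f_0,\dots,f_n$ are linearly dependent over $\mathbb{P}^n(k^\Delta)$ if and only if all generalized Wronskians $\mathcal{W}_A$, $A\in(\mathbb{N}^m)^{n+1}$, vanish on $(f_0,\dots,f_n)$.
   Context: $(\mathcal{U},\Delta)$, with $\Delta=\{\delta_1,\dots,\delta_m\}$ commuting derivations, is a universal domain: a sufficiently large saturated model of $DCF_{0,m}$ (characteristic $0$). For a differential field $F$, $F^\Delta$ denotes its field of constants (elements killed by all $\delta_i$). $\mathbb{P}^n(\mathcal{U}^\Delta)$ is regarded as a projective differential variety in $\mathbb{P}^n(\mathcal{U})$, consisting of the points having a representative with coordinates in $\mathcal{U}^\Delta$. $k$-large: a differential variety $V$ defined over $k$ is $k$-large with respect to $K$ if $V(k)=V(\bar K)$ for some (equivalently every) differential closure $\bar K$ of $K$, where $V(F)$ denotes the $F$-rational points of $V$. Linear dependence over $\mathbb{P}^n(k^\Delta)$: there is $[c_0:\cdots:c_n]\in\mathbb{P}^n(k^\Delta)$ with $\sum_{i=0}^n c_if_i=0$. Generalized Wronskians: for $\alpha=(\alpha_1,\dots,\alpha_m)\in\mathbb{N}^m$ write $\delta^\alpha=\delta_1^{\alpha_1}\cdots\delta_m^{\alpha_m}$. For $A=(\alpha^{(0)},\dots,\alpha^{(n)})\in(\mathbb{N}^m)^{n+1}$, $\mathcal{W}_A:=\det\big(\delta^{\alpha^{(i)}}y_j\big)_{0\le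 i,j\le n}$, a $\Delta$-polynomial in $y_0,\dots,y_n$. *)

theory Defs
  imports
    "HOL-Library.Equipollence"
    "HOL-Library.Poly_Mapping"
    "HOL-Algebra.Subrings"
    "Jordan_Normal_Form.Determinant"
begin

section \<open>Differential fields\<close>

text \<open>Derivations are indexed by \<open>0, \<dots>, m - 1\<close>; the values of \<open>der L i\<close> for \<open>i \<ge> m\<close> are never used.\<close>

record 'a dring = "'a ring" +
  der :: "nat \<Rightarrow> 'a \<Rightarrow> 'a"

definition differential_field :: "nat \<Rightarrow> 'a dring \<Rightarrow> bool" where
  "differential_field m L \<longleftrightarrow>
     field L \<and>
     (\<forall>r::nat. r > 0 \<longrightarrow> [r] \<cdot>\<^bsub>L\<^esub> \<one>\<^bsub>L\<^esub> \<noteq> \<zero>\<^bsub>L\<^esub>) \<and>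
     (\<forall>i<m. der L i \<in> carrier L \<rightarrow> carrier L) \<and>
     (\<forall>i<m. \<forall>x\<in>carrier L. \<forall>y\<in>carrier L.
        der L i (x \<oplus>\<^bsub>L\<^esub> y) = der L i x \<oplus>\<^bsub>L\<^esub> der L i y \<and>
        der L i (x \<otimes>\<^bsub>L\<^esub> y) = (der L i x \<otimes>\<^bsub>L\<^esub> y) \<oplus>\<^bsub>L\<^esub> (x \<otimes>\<^bsub>L\<^esub> der L i y)) \<and>
     (\<forall>i<m. \<forall>j<m. \<forall>x\<in>carrier L. der L i (der L j x) = der L j (der L i x))"

definition differential_embedding ::
    "nat \<Rightarrow> 'a dring \<Rightarrow> 'b dring \<Rightarrow> ('a \<Rightarrow> 'b) \<Rightarrow> bool" where
  "differential_embedding m K L h \<longleftrightarrow>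
     h \<in> Ring.ring_hom K L \<and> (\<forall>i<m. \<forall>x\<in>carrier K. h (der K i x) = der L i (h x))"

section \<open>First-order formulas over differential rings\<close>

datatype (ders_tm: 'd, pars_tm: 'a) tm =
    Var nat
  | Par 'a
  | Zero_tm
  | One_tm
  | Plus_tm "('d, 'a) tm" "('d, 'a) tm"
  | Neg_tm "('d, 'a) tm"
  | Times_tm "('d, 'a) tm" "('d, 'a) tm"
  | Der_tm 'd "('d, 'a) tm"

datatype (ders_fm: 'd, pars_fm: 'a) fm =
    Eq_fm "('d, 'a) tm" "('d, 'a) tm"
  | Not_fm "('d, 'a) fm"
  | And_fm "('d, 'a) fm" "('d, 'a) fm"
  | Ex_fm nat "('d, 'a) fm"

primrec eval_tm :: "'a dring \<Rightarrow> (nat \<Rightarrow> 'a) \<Rightarrow> (nat, 'a) tm \<Rightarrow> 'a" where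
  "eval_tm L v (Var x) = v x"
| "eval_tm L v (Par a) = a"
| "eval_tm L v Zero_tm = \<zero>\<^bsub>L\<^esub>"
| "eval_tm L v One_tm = \<one>\<^bsub>L\<^esub>"
| "eval_tm L v (Plus_tm s t) = eval_tm L v s \<oplus>\<^bsub>L\<^esub> eval_tm L v t"
| "eval_tm L v (Neg_tm t) = \<ominus>\<^bsub>L\<^esub> eval_tm L v t"
| "eval_tm L v (Times_tm s t) = eval_tm L v s \<otimes>\<^bsub>L\<^esub> eval_tm L v t"
| "eval_tm L v (Der_tm i t) = der L i (eval_tm L v t)"

primrec sat :: "'a dring \<Rightarrow> (nat \<Rightarrow> 'a) \<Rightarrow> (nat, 'a) fm \<Rightarrow> bool" where
  "sat L v (Eq_fm s t) \<longleftrightarrow> eval_tm L v s = eval_tm L v t"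
| "sat L v (Not_fm \<phi>) \<longleftrightarrow> \<not> sat L v \<phi>"
| "sat L v (And_fm \<phi> \<psi>) \<longleftrightarrow> sat L v \<phi> \<and> sat L v \<psi>"
| "sat L v (Ex_fm x \<phi>) \<longleftrightarrow> (\<exists>a\<in>carrier L. sat L (v(x := a)) \<phi>)"

primrec fv_tm :: "('d, 'a) tm \<Rightarrow> nat set" where
  "fv_tm (Var x) = {x}"
| "fv_tm (Par a) = {}"
| "fv_tm Zero_tm = {}"
| "fv_tm One_tm = {}"
| "fv_tm (Plus_tm s t) = fv_tm s \<union> fv_tm t"
| "fv_tm (Neg_tm t) = fv_tm t"
| "fv_tm (Times_tm s t) = fv_tm s \<union> fv_tm t"
| "fv_tm (Der_tm i t) = fv_tm t"

primrec fv_fm :: "('d, 'a) fm \<Rightarrow> nat set" where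
  "fv_fm (Eq_fm s t) = fv_tm s \<union> fv_tm t"
| "fv_fm (Not_fm \<phi>) = fv_fm \<phi>"
| "fv_fm (And_fm \<phi> \<psi>) = fv_fm \<phi> \<union> fv_fm \<psi>"
| "fv_fm (Ex_fm x \<phi>) = fv_fm \<phi> - {x}"

primrec quantifier_free :: "('d, 'a) fm \<Rightarrow> bool" where
  "quantifier_free (Eq_fm s t) \<longleftrightarrow> True"
| "quantifier_free (Not_fm \<phi>) \<longleftrightarrow> quantifier_free \<phi>"
| "quantifier_free (And_fm \<phi> \<psi>) \<longleftrightarrow> quantifier_free \<phi> \<and> quantifier_free \<psi>"
| "quantifier_free (Ex_fm x \<phi>) \<longleftrightarrow> False"

text \<open>Formulas in the language of rings with \<open>m\<close> derivations and parameters from \<open>A\<close>.\<close>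

definition formulas_over :: "nat \<Rightarrow> 'a set \<Rightarrow> (nat, 'a) fm set" where
  "formulas_over m A = {\<phi>. ders_fm \<phi> \<subseteq> {..<m} \<and> pars_fm \<phi> \<subseteq> A}"

section \<open>Differentially closed fields, saturation, differential closures\<close>

text \<open>
  The theory \<open>DCF\<^sub>0\<^sub>,\<^sub>m\<close> is the model companion of the theory of differential fields of
  characteristic \<open>0\<close> with \<open>m\<close> commuting derivations, so its models are the existentially closed
  such fields. Letting the extension \<open>L\<close> range over structures on the type of \<open>F\<close> loses nothing:
  \<open>F\<close> is infinite, so the differential subfield of \<open>L\<close> generated by \<open>F\<close> and a finite tuple has
  the cardinality of \<open>F\<close> and can be copied into that type.
\<close>

definition differentially_closed :: "nat \<Rightarrow> 'a dring \<Rightarrow> bool" where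
  "differentially_closed m F \<longleftrightarrow>
     differential_field m F \<and>
     (\<forall>(L :: 'a dring) h \<phi>.
        differential_field m L \<longrightarrow> differential_embedding m F L h \<longrightarrow>
        quantifier_free \<phi> \<longrightarrow> \<phi> \<in> formulas_over m (carrier F) \<longrightarrow>
        (\<exists>v. range v \<subseteq> carrier L \<and> sat L v (map_fm id h \<phi>)) \<longrightarrow>
        (\<exists>v. range v \<subseteq> carrier F \<and> sat F v \<phi>))"

text \<open>
  Every finitely satisfiable set of formulas in the single free variable \<open>0\<close> over fewer than
  \<open>|M|\<close> parameters is realised in \<open>M\<close>.
\<close>

definition saturated :: "nat \<Rightarrow> 'a dring \<Rightarrow> bool" where
  "saturated m M \<longleftrightarrow>
     (\<forall>A p. A \<subseteq> carrier M \<longrightarrow> A \<prec> carrier M \<longrightarrow>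
        p \<subseteq> formulas_over m A \<longrightarrow> (\<forall>\<phi>\<in>p. fv_fm \<phi> \<subseteq> {0}) \<longrightarrow>
        (\<forall>q. q \<subseteq> p \<longrightarrow> finite q \<longrightarrow> (\<exists>a\<in>carrier M. \<forall>\<phi>\<in>q. sat M (\<lambda>_. a) \<phi>)) \<longrightarrow>
        (\<exists>a\<in>carrier M. \<forall>\<phi>\<in>p. sat M (\<lambda>_. a) \<phi>))"

text \<open>
  The universal domain is a whole type \<open>'a\<close>, with derivations \<open>\<delta>\<close>; subsets of it are viewed as
  structures with the restricted operations.
\<close>

definition dstruct :: "(nat \<Rightarrow> 'a \<Rightarrow> 'a) \<Rightarrow> 'a set \<Rightarrow> 'a::field dring" where
  "dstruct \<delta> F =
     \<lparr>carrier = F, monoid.mult = (*), one = 1, zero = 0, add = (+), der = \<delta>\<rparr>"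

definition universal_domain :: "nat \<Rightarrow> (nat \<Rightarrow> 'a \<Rightarrow> 'a::field) \<Rightarrow> bool" where
  "universal_domain m \<delta> \<longleftrightarrow>
     differentially_closed m (dstruct \<delta> UNIV) \<and> saturated m (dstruct \<delta> UNIV)"

text \<open>
  Small subsets are those of cardinality less than that of the universal domain. A small
  differential field is infinite, so its existence makes the universal domain uncountable.
\<close>

definition small :: "'a set \<Rightarrow> bool" where
  "small A \<longleftrightarrow> A \<prec> (UNIV :: 'a set)"

definition differential_subfield :: "nat \<Rightarrow> (nat \<Rightarrow> 'a \<Rightarrow> 'a::field) \<Rightarrow> 'a set \<Rightarrow> bool" where
  "differential_subfield m \<delta> F \<longleftrightarrow>
     subfield F (dstruct \<delta> UNIV) \<and> (\<forall>i<m. \<forall>x\<in>F. \<delta> i x \<in> F)"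

text \<open>
  A differential closure of \<open>K\<close> is a differentially closed extension that embeds over \<open>K\<close> into
  every differentially closed extension of \<open>K\<close>. By downward Loewenheim-Skolem it suffices to
  test this on structures on the type of the universal domain.
\<close>

definition differential_closure ::
    "nat \<Rightarrow> (nat \<Rightarrow> 'a \<Rightarrow> 'a::field) \<Rightarrow> 'a set \<Rightarrow> 'a set \<Rightarrow> bool" where
  "differential_closure m \<delta> K C \<longleftrightarrow>
     K \<subseteq> C \<and> differential_subfield m \<delta> C \<and> differentially_closed m (dstruct \<delta> C) \<and>
     (\<forall>(L :: 'a dring) h.
        differentially_closed m L \<longrightarrow> differential_embedding m (dstruct \<delta> K) L h \<longrightarrow>
        (\<exists>g. differential_embedding m (dstruct \<delta> C) L g \<and> (\<forall>x\<in>K. g x = h x)))"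

definition constants :: "nat \<Rightarrow> (nat \<Rightarrow> 'a \<Rightarrow> 'a::field) \<Rightarrow> 'a set \<Rightarrow> 'a set" where
  "constants m \<delta> F = {x\<in>F. \<forall>i<m. \<delta> i x = 0}"

section \<open>Projective space and rational points\<close>

text \<open>
  Points of \<open>\<PP>\<^sup>n\<close> of the universal domain are classes of nonzero vectors of length \<open>n + 1\<close> modulo
  scaling, so the elements of a point are its homogeneous coordinate vectors.
\<close>

definition proj_rel :: "nat \<Rightarrow> ('a::field vec \<times> 'a vec) set" where
  "proj_rel n = {(v, w). v \<in> carrier_vec (Suc n) - {0\<^sub>v (Suc n)} \<and> (\<exists>c. c \<noteq> 0 \<and> w = c \<cdot>\<^sub>v v)}"

definition proj_space :: "nat \<Rightarrow> 'a::field vec set set" where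
  "proj_space n = (carrier_vec (Suc n) - {0\<^sub>v (Suc n)}) // proj_rel n"

definition rational_points :: "'a vec set set \<Rightarrow> 'a set \<Rightarrow> 'a vec set set" where
  "rational_points V F = {p\<in>V. \<exists>v\<in>p. \<forall>i<dim_vec v. v $ i \<in> F}"

text \<open>For a subfield \<open>F\<close>, this is \<open>\<PP>\<^sup>n(F)\<close> as a subset of \<open>\<PP>\<^sup>n\<close> of the universal domain.\<close>

definition proj_points :: "nat \<Rightarrow> 'a::field set \<Rightarrow> 'a vec set set" where
  "proj_points n F = rational_points (proj_space n) F"

text \<open>Meant for projective differential varieties \<open>V\<close> defined over \<open>k\<close>, given as sets of points.
  Any two differential closures of \<open>K\<close> are isomorphic over \<open>K\<close>, so asking this of some closure or of
  every closure is the same.\<close>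

definition large_wrt ::
    "nat \<Rightarrow> (nat \<Rightarrow> 'a \<Rightarrow> 'a::field) \<Rightarrow> 'a set \<Rightarrow> 'a set \<Rightarrow> 'a vec set set \<Rightarrow> bool" where
  "large_wrt m \<delta> k K V \<longleftrightarrow>
     (\<exists>C. differential_closure m \<delta> K C \<and> rational_points V k = rational_points V C)"

definition linearly_dependent_over ::
    "nat \<Rightarrow> (nat \<Rightarrow> 'a::field) \<Rightarrow> 'a vec set set \<Rightarrow> bool" where
  "linearly_dependent_over n f P \<longleftrightarrow> (\<exists>p\<in>P. \<exists>c\<in>p. (\<Sum>i\<le>n. c $ i * f i) = 0)"

section \<open>Differential polynomials and generalized Wronskians\<close>

definition multi_indices :: "nat \<Rightarrow> (nat \<Rightarrow> nat) set" where
  "multi_indices m = {\<alpha>. \<forall>l\<ge>m. \<alpha> l = 0}"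

definition der_power :: "nat \<Rightarrow> (nat \<Rightarrow> 'a \<Rightarrow> 'a) \<Rightarrow> (nat \<Rightarrow> nat) \<Rightarrow> 'a \<Rightarrow> 'a" where
  "der_power m \<delta> \<alpha> = foldr (\<lambda>l. \<delta> l ^^ \<alpha> l) [0..<m]"

text \<open>The index \<open>(j, \<alpha>)\<close> stands for the indeterminate \<open>\<delta>\<^sup>\<alpha> y\<^sub>j\<close>.\<close>

type_synonym 'a dpoly = "((nat \<times> (nat \<Rightarrow> nat)) \<Rightarrow>\<^sub>0 nat) \<Rightarrow>\<^sub>0 'a"

definition dindet :: "nat \<Rightarrow> (nat \<Rightarrow> nat) \<Rightarrow> 'a::field dpoly" where
  "dindet j \<alpha> = Poly_Mapping.single (Poly_Mapping.single (j, \<alpha>) 1) 1"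

definition eval_dpoly ::
    "nat \<Rightarrow> (nat \<Rightarrow> 'a \<Rightarrow> 'a) \<Rightarrow> (nat \<Rightarrow> 'a) \<Rightarrow> 'a::field dpoly \<Rightarrow> 'a" where
  "eval_dpoly m \<delta> f P =
     (\<Sum>M\<in>Poly_Mapping.keys P. Poly_Mapping.lookup P M *
        (\<Prod>x\<in>Poly_Mapping.keys M.
           der_power m \<delta> (snd x) (f (fst x)) ^ Poly_Mapping.lookup M x))"

definition gen_wronskian :: "nat \<Rightarrow> (nat \<Rightarrow> nat \<Rightarrow> nat) \<Rightarrow> 'a::field dpoly" where
  "gen_wronskian n A = det (mat (Suc n) (Suc n) (\<lambda>(i, j). dindet j (A i)))"

end

theory Submission
  imports Defs
begin

text \<open>
  A projective relation between the \<open>f\<^sub>j\<close> with constant coefficients is inherited by all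
  derivatives \<open>\<delta>\<^sup>\<alpha> f\<^sub>j\<close>, so every generalized Wronskian vanishes. Conversely, take \<open>N\<close>
  least such that all Wronskians of \<open>f\<^sub>0, \<dots>, f\<^sub>N\<close> vanish, and a nonvanishing Wronskian of
  \<open>f\<^sub>0, \<dots>, f\<^sub>N\<^sub>-\<^sub>1\<close>. The cofactors along an extra row give a relation with coefficients in
  \<open>K\<close>, satisfied by all derivatives and with last coefficient \<open>1\<close>. Differentiating it gives a shorter relation, which the nonvanishing
  Wronskian forces to be trivial; so the coefficients are constants of \<open>K\<close>, and largeness moves
  the corresponding point of projective space into \<open>k\<close>.
\<close>

section \<open>Evaluation of differential polynomials\<close>

lemma sum_single_lookup:
  "(\<Sum>M\<in>Poly_Mapping.keys P. Poly_Mapping.single M (Poly_Mapping.lookup P M)) = P"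
  by (rule poly_mapping_eqI)
    (simp add: lookup_sum lookup_single when_def sum.delta in_keys_iff)

text \<open>Multiplying monomials adds their exponents. All three products are first taken over one
  common support, where each additional factor is a zeroth power.\<close>

lemma prod_power_keys_add:
  fixes g :: "'x \<Rightarrow> 'a::comm_semiring_1"
  shows "(\<Prod>x\<in>Poly_Mapping.keys (M + N). g x ^ Poly_Mapping.lookup (M + N) x) =
    (\<Prod>x\<in>Poly_Mapping.keys M. g x ^ Poly_Mapping.lookup M x) *
    (\<Prod>x\<in>Poly_Mapping.keys N. g x ^ Poly_Mapping.lookup N x)"
proof -
  define S where "S = Poly_Mapping.keys M \<union> Poly_Mapping.keys N"
  have *: "(\<Prod>x\<in>Poly_Mapping.keys L. g x ^ Poly_Mapping.lookup L x) =
      (\<Prod>x\<in>S. g x ^ Poly_Mapping.lookup L x)" if "Poly_Mapping.keys L \<subseteq> S" for L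
    by (rule prod.mono_neutral_left) (use that in \<open>auto simp: S_def in_keys_iff\<close>)
  have "Poly_Mapping.keys (M + N) \<subseteq> S"
    unfolding S_def by (rule Poly_Mapping.keys_add)
  moreover have "Poly_Mapping.keys M \<subseteq> S" "Poly_Mapping.keys N \<subseteq> S"
    by (auto simp: S_def)
  ultimately show ?thesis
    by (simp only: *) (simp add: lookup_add power_add prod.distrib)
qed

lemma eval_dpoly_single:
  "eval_dpoly m \<delta> f (Poly_Mapping.single M c) =
    c * (\<Prod>x\<in>Poly_Mapping.keys M. der_power m \<delta> (snd x) (f (fst x)) ^ Poly_Mapping.lookup M x)"
  by (cases "c = 0") (auto simp: eval_dpoly_def)

lemma eval_dpoly_zero [simp]: "eval_dpoly m \<delta> f 0 = 0"
  by (simp add: eval_dpoly_def)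

lemma eval_dpoly_add:
  "eval_dpoly m \<delta> f (P + Q) = eval_dpoly m \<delta> f P + eval_dpoly m \<delta> f Q"
proof -
  \<comment> \<open>Cancellation can make the support of \<open>P + Q\<close> smaller than the
    union. Summing over the union is harmless, since the extra coefficients are 0.\<close>
  define S where "S = Poly_Mapping.keys P \<union> Poly_Mapping.keys Q"
  define e where "e M = (\<Prod>x\<in>Poly_Mapping.keys M.
    der_power m \<delta> (snd x) (f (fst x)) ^ Poly_Mapping.lookup M x)" for M
  have *: "eval_dpoly m \<delta> f R = (\<Sum>M\<in>S. Poly_Mapping.lookup R M * e M)"
    if "Poly_Mapping.keys R \<subseteq> S" for R
    unfolding eval_dpoly_def e_def[symmetric]
    by (rule sum.mono_neutral_left) (use that in \<open>auto simp: S_def in_keys_iff\<close>)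
  have "Poly_Mapping.keys (P + Q) \<subseteq> S"
    unfolding S_def by (rule Poly_Mapping.keys_add)
  moreover have "Poly_Mapping.keys P \<subseteq> S" "Poly_Mapping.keys Q \<subseteq> S"
    by (auto simp: S_def)
  ultimately show ?thesis
    by (simp add: * lookup_add distrib_right sum.distrib)
qed

lemma eval_dpoly_sum:
  "eval_dpoly m \<delta> f (\<Sum>i\<in>I. P i) = (\<Sum>i\<in>I. eval_dpoly m \<delta> f (P i))"
  by (induction I rule: infinite_finite_induct) (simp_all add: eval_dpoly_add)

lemma eval_dpoly_mult:
  "eval_dpoly m \<delta> f (P * Q) = eval_dpoly m \<delta> f P * eval_dpoly m \<delta> f Q"
proof -
  \<comment> \<open>By additivity it is enough to multiply single terms, where
    \<open>prod_power_keys_add\<close> applies.\<close>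
  let ?s = "\<lambda>R M. Poly_Mapping.single M (Poly_Mapping.lookup R M)"
  have "eval_dpoly m \<delta> f (P * Q) =
      eval_dpoly m \<delta> f ((\<Sum>M\<in>Poly_Mapping.keys P. ?s P M) * (\<Sum>N\<in>Poly_Mapping.keys Q. ?s Q N))"
    by (simp only: sum_single_lookup)
  also have "\<dots> = (\<Sum>M\<in>Poly_Mapping.keys P. \<Sum>N\<in>Poly_Mapping.keys Q.
      eval_dpoly m \<delta> f (?s P M) * eval_dpoly m \<delta> f (?s Q N))"
    by (simp add: sum_product eval_dpoly_sum mult_single eval_dpoly_single prod_power_keys_add mult_ac)
  also have "\<dots> = eval_dpoly m \<delta> f (\<Sum>M\<in>Poly_Mapping.keys P. ?s P M) *
      eval_dpoly m \<delta> f (\<Sum>N\<in>Poly_Mapping.keys Q. ?s Q N)"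
    by (simp only: sum_product eval_dpoly_sum)
  finally show ?thesis
    by (simp only: sum_single_lookup)
qed

lemma eval_dpoly_one: "eval_dpoly m \<delta> f 1 = 1"
  using eval_dpoly_single[of m \<delta> f 0 1] by simp

lemma comm_ring_hom_eval_dpoly: "comm_ring_hom (eval_dpoly m \<delta> f)"
  by unfold_locales (simp_all add: eval_dpoly_add eval_dpoly_mult eval_dpoly_one)

lemma eval_dpoly_dindet: "eval_dpoly m \<delta> f (dindet j \<alpha>) = der_power m \<delta> \<alpha> (f j)"
  by (simp add: dindet_def eval_dpoly_single)

text \<open>Evaluation is a ring homomorphism and so commutes with determinants. From here on
  Wronskians are determinants over the field itself.\<close>

lemma eval_gen_wronskian:
  "eval_dpoly m \<delta> f (gen_wronskian n A) =
    det (mat (Suc n) (Suc n) (\<lambda>(i, j). der_power m \<delta> (A i) (f j)))"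
proof -
  interpret comm_ring_hom "eval_dpoly m \<delta> f"
    by (rule comm_ring_hom_eval_dpoly)
  have "map_mat (eval_dpoly m \<delta> f) (mat (Suc n) (Suc n) (\<lambda>(i, j). dindet j (A i))) =
      mat (Suc n) (Suc n) (\<lambda>(i, j). der_power m \<delta> (A i) (f j))"
    by (rule eq_matI) (auto simp: eval_dpoly_dindet)
  then show ?thesis
    unfolding gen_wronskian_def by (metis hom_det)
qed

section \<open>Differential subfields of the universal domain\<close>

lemma dstruct_simps [simp]:
  "carrier (dstruct \<delta> F) = F" "monoid.mult (dstruct \<delta> F) = (*)" "one (dstruct \<delta> F) = 1"
  "zero (dstruct \<delta> F) = 0" "add (dstruct \<delta> F) = (+)" "der (dstruct \<delta> F) = \<delta>"
  by (simp_all add: dstruct_def)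

text \<open>The record view in \<open>field_dstruct\<close> serves the theory of subfields; the
  derivation laws use the type class operations, in which all computations are done.\<close>

locale commuting_derivations =
  fixes m :: nat and \<delta> :: "nat \<Rightarrow> 'a \<Rightarrow> 'a::field"
  assumes field_dstruct: "field (dstruct \<delta> UNIV)"
    and der_add: "i < m \<Longrightarrow> \<delta> i (x + y) = \<delta> i x + \<delta> i y"
    and der_mult: "i < m \<Longrightarrow> \<delta> i (x * y) = \<delta> i x * y + x * \<delta> i y"
    and der_commute: "i < m \<Longrightarrow> j < m \<Longrightarrow> \<delta> i (\<delta> j x) = \<delta> j (\<delta> i x)"
begin

lemma der_0 [simp]: "i < m \<Longrightarrow> \<delta> i 0 = 0"
  using der_add[of i 0 0] by (metis add.right_neutral add_cancel_right_right)

lemma der_1 [simp]: "i < m \<Longrightarrow> \<delta> i 1 = 0"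
  using der_mult[of i 1 1] by (metis add_cancel_right_right mult_1 mult_1_right)

lemma der_sum: "i < m \<Longrightarrow> \<delta> i (\<Sum>j\<in>I. x j) = (\<Sum>j\<in>I. \<delta> i (x j))"
  by (induction I rule: infinite_finite_induct) (simp_all add: der_add)

lemma constants_divide:
  assumes x: "x \<in> constants m \<delta> UNIV" and y: "y \<in> constants m \<delta> UNIV"
  shows "x / y \<in> constants m \<delta> UNIV"
proof (cases "y = 0")
  case True
  \<comment> \<open>Division by 0 yields 0, which is a constant.\<close>
  then show ?thesis by (simp add: constants_def)
next
  case False
  \<comment> \<open>The Leibniz rule is applied to the product \<open>x / y * y\<close>, which
    equals \<open>x\<close>; then \<open>y\<close> is cancelled.\<close>
  have "\<delta> i (x / y) = 0" if i: "i < m" for i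
  proof -
    have "\<delta> i (x / y * y) = \<delta> i (x / y) * y"
      using y i by (subst der_mult) (simp_all add: constants_def)
    moreover have "\<delta> i (x / y * y) = 0"
      using x i False by (simp add: constants_def)
    ultimately show ?thesis using False by simp
  qed
  then show ?thesis by (simp add: constants_def)
qed

section \<open>Iterated derivatives\<close>

lemma foldr_der_induct:
  assumes "P id" and "\<And>l F. l < m \<Longrightarrow> P F \<Longrightarrow> P (\<delta> l \<circ> F)" and "set ls \<subseteq> {..<m}"
  shows "P (foldr (\<lambda>l. \<delta> l ^^ \<alpha> l) ls)"
  using assms(3)
proof (induction ls)
  case Nil
  then show ?case using assms(1) by (simp add: id_def)
next
  case (Cons l ls)
  \<comment> \<open>An inner induction on the exponent peels off one derivation at a time, as the
    premise on \<open>P\<close> allows only a single one.\<close>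
  have "P ((\<delta> l ^^ i) \<circ> foldr (\<lambda>l. \<delta> l ^^ \<alpha> l) ls)" for i
  proof (induction i)
    case 0
    then show ?case using Cons by simp
  next
    case (Suc i)
    have "l < m" using Cons.prems by simp
    from assms(2)[OF this Suc] show ?case by (simp only: funpow.simps comp_assoc)
  qed
  then show ?case by (simp only: foldr.simps)
qed

text \<open>Since \<delta>^\<alpha> is a composite of single derivations, a property of maps passes
  to it from the identity once it survives one more derivation on the left.\<close>

lemma der_power_induct [case_names id der]:
  assumes "P id" and "\<And>l F. l < m \<Longrightarrow> P F \<Longrightarrow> P (\<delta> l \<circ> F)"
  shows "P (der_power m \<delta> \<alpha>)"
  unfolding der_power_def by (rule foldr_der_induct[OF assms]) auto

lemma der_power_zero: "der_power m \<delta> (\<lambda>_. 0) x = x"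
proof -
  have "foldr (\<lambda>l. \<delta> l ^^ 0) ls x = x" for ls
    by (induction ls) auto
  then show ?thesis by (simp add: der_power_def)
qed

lemma der_funpow_commute:
  "i < m \<Longrightarrow> j < m \<Longrightarrow> \<delta> i ((\<delta> j ^^ r) x) = (\<delta> j ^^ r) (\<delta> i x)"
  by (induction r) (simp_all add: der_commute[of i j])

text \<open>The new derivation commutes past the blocks of the other derivations until it joins the
  block of \<delta>_l. The list is general so that induction can shorten it.\<close>

lemma der_foldr:
  assumes "set ls \<subseteq> {..<m}" "distinct ls" "l \<in> set ls"
  shows "\<delta> l (foldr (\<lambda>l. \<delta> l ^^ \<alpha> l) ls x) =
    foldr (\<lambda>i. \<delta> i ^^ (\<alpha>(l := Suc (\<alpha> l))) i) ls x"
  using assms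
proof (induction ls)
  case Nil
  then show ?case by simp
next
  case (Cons a ls)
  show ?case
  proof (cases "a = l")
    case True
    \<comment> \<open>By distinctness \<open>l\<close> does not occur in the tail, so raising its
      exponent leaves the tail unchanged.\<close>
    have "foldr (\<lambda>i. \<delta> i ^^ (\<alpha>(l := Suc (\<alpha> l))) i) ls x = foldr (\<lambda>i. \<delta> i ^^ \<alpha> i) ls x"
      by (rule foldr_cong) (use Cons.prems True in auto)
    then show ?thesis using True by simp
  next
    case False
    then show ?thesis using Cons by (auto simp: der_funpow_commute)
  qed
qed

lemma der_der_power:
  "l < m \<Longrightarrow> \<delta> l (der_power m \<delta> \<alpha> x) = der_power m \<delta> (\<alpha>(l := Suc (\<alpha> l))) x"
  unfolding der_power_def by (rule der_foldr) auto

lemma der_power_linear: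
  assumes "\<And>j. j \<in> I \<Longrightarrow> c j \<in> constants m \<delta> UNIV"
  shows "der_power m \<delta> \<alpha> (\<Sum>j\<in>I. c j * x j) = (\<Sum>j\<in>I. c j * der_power m \<delta> \<alpha> (x j))"
proof (induction rule: der_power_induct)
  case id
  show ?case by simp
next
  case (der l F)
  then show ?case using assms by (simp add: der_sum der_mult constants_def)
qed

section \<open>Closure properties of differential subfields\<close>

lemma der_power_closed:
  assumes "differential_subfield m \<delta> K" "x \<in> K"
  shows "der_power m \<delta> \<alpha> x \<in> K"
  by (induction rule: der_power_induct) (use assms in \<open>auto simp: differential_subfield_def\<close>)

lemma differential_subfield_closed:
  assumes K: "differential_subfield m \<delta> K"
  shows "0 \<in> K" "1 \<in> K" "x \<in> K \<Longrightarrow> y \<in> K \<Longrightarrow> x + y \<in> K" "x \<in> K \<Longrightarrow> y \<in> K \<Longrightarrow> x * y \<in> K"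
    "x \<in> K \<Longrightarrow> - x \<in> K" "x \<in> K \<Longrightarrow> y \<in> K \<Longrightarrow> x / y \<in> K"
proof -
  interpret R: field "dstruct \<delta> UNIV" by (rule field_dstruct)
  have sf: "subfield K (dstruct \<delta> UNIV)"
    using K by (simp add: differential_subfield_def)
  note sr = subringE[OF subfieldE(1)[OF sf]]
  show "0 \<in> K" "1 \<in> K" "x \<in> K \<Longrightarrow> y \<in> K \<Longrightarrow> x + y \<in> K"
    and m: "x \<in> K \<Longrightarrow> y \<in> K \<Longrightarrow> x * y \<in> K" for x y
    using sr(2,3,6,7) by simp_all
  \<comment> \<open>The negative of the record is an abstract inverse; uniqueness of additive
    inverses identifies it with \<open>- x\<close>.\<close>
  have "\<ominus>\<^bsub>dstruct \<delta> UNIV\<^esub> x = - x"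
    using R.l_neg[of x] unfolding dstruct_simps by (simp add: eq_neg_iff_add_eq_0)
  then show "x \<in> K \<Longrightarrow> - x \<in> K"
    using sr(5)[of x] by simp
  show "x / y \<in> K" if xy: "x \<in> K" "y \<in> K"
  proof (cases "y = 0")
    case True
    then show ?thesis using \<open>0 \<in> K\<close> by simp
  next
    case False
    then obtain z where "z \<in> K" "y * z = 1"
      using R.subfield_m_inv(1,2)[OF sf, of y] xy by auto
    then have "x / y = x * z"
      using False by (simp add: field_simps)
    then show ?thesis using m xy \<open>z \<in> K\<close> by simp
  qed
qed

text \<open>By the Leibniz formula a determinant is a signed sum of products of entries.\<close>

lemma det_closed:
  assumes K: "differential_subfield m \<delta> K" and A: "A \<in> carrier_mat n n"
    and mem: "\<And>i j. i < n \<Longrightarrow> j < n \<Longrightarrow> A $$ (i, j) \<in> K"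
  shows "det A \<in> K"
proof -
  note c = differential_subfield_closed[OF K]
  have s: "sum g I \<in> K" if "\<And>i. i \<in> I \<Longrightarrow> g i \<in> K" for g :: "(nat \<Rightarrow> nat) \<Rightarrow> 'a" and I
    using that by (induction I rule: infinite_finite_induct) (auto intro: c)
  have p: "prod g I \<in> K" if "\<And>i. i \<in> I \<Longrightarrow> g i \<in> K" for g :: "nat \<Rightarrow> 'a" and I
    using that by (induction I rule: infinite_finite_induct) (auto intro: c)
  have "signof p \<in> K" for p :: "nat \<Rightarrow> nat"
    by (auto simp: sign_def intro: c)
  moreover have "(\<Prod>i = 0..<n. A $$ (i, p i)) \<in> K" if "p permutes {0..<n}" for p
    by (rule p) (use that permutes_in_image[OF that] in \<open>auto intro!: mem\<close>)
  ultimately show ?thesis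
    unfolding det_def'[OF A] by (auto intro!: s c)
qed

section \<open>The Wronskian criterion\<close>

text \<open>The coefficient vector is a nonzero kernel vector of the matrix, whichever rows
  \<open>A\<close> selects.\<close>

lemma relation_imp_wronskian_eq_0:
  assumes "\<And>j. j < N \<Longrightarrow> c j \<in> constants m \<delta> UNIV" and "j < N" "c j \<noteq> 0"
    and "(\<Sum>j<N. c j * f j) = 0"
  shows "det (mat N N (\<lambda>(i, j). der_power m \<delta> (A i) (f j))) = 0"
proof -
  let ?M = "mat N N (\<lambda>(i, j). der_power m \<delta> (A i) (f j))"
  have rel: "(\<Sum>j<N. c j * der_power m \<delta> \<alpha> (f j)) = 0" for \<alpha>
  proof -
    have "der_power m \<delta> \<alpha> 0 = 0"
      using der_power_linear[of "{}"] by simp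
    then show ?thesis
      using assms der_power_linear[of "{..<N}" c \<alpha> f] by simp
  qed
  have "?M *\<^sub>v vec N c = 0\<^sub>v N"
    using rel by (intro eq_vecI) (simp_all add: scalar_prod_def mult.commute lessThan_atLeast0)
  moreover have "vec N c \<noteq> 0\<^sub>v N"
    using assms(2,3) by (metis index_vec index_zero_vec(1))
  ultimately show ?thesis
    by (subst det_0_iff_vec_prod_zero[of _ N]) (auto intro!: exI[of _ "vec N c"])
qed

text \<open>The nonsingular matrix \<open>B\<close> is bordered by the column of \<open>f N\<close>
  and a row of derivatives of order \<alpha>. The cofactors along that row do not depend on
  \<alpha>, so one coefficient vector works for every \<alpha>.\<close>

lemma relation_from_maximal_wronskian:
  assumes K: "differential_subfield m \<delta> K"
    and f: "\<And>j. j \<le> N \<Longrightarrow> f j \<in> K"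
    and A: "\<And>i. i < N \<Longrightarrow> A i \<in> multi_indices m"
    and nz: "det (mat N N (\<lambda>(i, j). der_power m \<delta> (A i) (f j))) \<noteq> 0"
    and zero: "\<And>A. (\<And>i. i < Suc N \<Longrightarrow> A i \<in> multi_indices m) \<Longrightarrow>
      det (mat (Suc N) (Suc N) (\<lambda>(i, j). der_power m \<delta> (A i) (f j))) = 0"
  shows "\<exists>c. (\<forall>j\<le>N. c j \<in> constants m \<delta> K) \<and> c N = 1 \<and> (\<Sum>j<Suc N. c j * f j) = 0"
proof -
  define B where "B = mat N N (\<lambda>(i, j). der_power m \<delta> (A i) (f j))"
  define M where "M \<alpha> = mat (Suc N) (Suc N)
    (\<lambda>(i, j). der_power m \<delta> (if i < N then A i else \<alpha>) (f j))" for \<alpha>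
  \<comment> \<open>The index 0 is an arbitrary choice of \<alpha>. Division by \<open>det B\<close>
    normalizes the last coefficient to 1.\<close>
  define c where "c j = cofactor (M (\<lambda>_. 0)) N j / det B" for j
  have M: "M \<alpha> \<in> carrier_mat (Suc N) (Suc N)" for \<alpha>
    by (simp add: M_def)
  have B: "B \<in> carrier_mat N N" and detB: "det B \<noteq> 0"
    using nz by (simp_all add: B_def)
  \<comment> \<open>Deleting row \<open>N\<close> removes the only row containing \<alpha>, which is
    why the right-hand side is free of it.\<close>
  have delete: "mat_delete (M \<alpha>) N j =
      mat N N (\<lambda>(i, l). der_power m \<delta> (A i) (f (if l < j then l else Suc l)))" for \<alpha> j
    by (rule eq_matI) (auto simp: mat_delete_def M_def)
  have cofactor: "cofactor (M \<alpha>) N j = c j * det B" for \<alpha> j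
    using detB by (simp add: c_def cofactor_def delete)
  \<comment> \<open>Laplace expansion of the singular matrix \<open>M \<alpha>\<close> along its
    last row.\<close>
  have rel: "(\<Sum>j<Suc N. c j * der_power m \<delta> \<alpha> (f j)) = 0" if "\<alpha> \<in> multi_indices m" for \<alpha>
  proof -
    have "det (M \<alpha>) = 0"
      unfolding M_def by (rule zero) (use that A in auto)
    then have "(\<Sum>j<Suc N. M \<alpha> $$ (N, j) * cofactor (M \<alpha>) N j) = 0"
      using laplace_expansion_row[OF M, of N \<alpha>] by simp
    moreover have "(\<Sum>j<Suc N. M \<alpha> $$ (N, j) * cofactor (M \<alpha>) N j) =
        (\<Sum>j<Suc N. c j * der_power m \<delta> \<alpha> (f j)) * det B"
      unfolding sum_distrib_right by (rule sum.cong) (auto simp: cofactor, auto simp: M_def)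
    ultimately show ?thesis using detB by simp
  qed
  have "mat_delete (M \<alpha>) N N = B" for \<alpha>
    unfolding delete B_def by (rule eq_matI) auto
  then have cN: "c N = 1"
    using detB by (simp add: c_def cofactor_def)
  have cK: "c j \<in> K" if "j \<le> N" for j
  proof -
    note cl = differential_subfield_closed[OF K]
    have "(-1) ^ r \<in> K" for r
      by (induction r) (auto intro: cl)
    moreover have "det (mat_delete (M (\<lambda>_. 0)) N j) \<in> K"
      by (rule det_closed[OF K, of _ N]) (auto simp: delete intro!: der_power_closed[OF K] f)
    moreover have "det B \<in> K"
      by (rule det_closed[OF K B]) (auto simp: B_def intro!: der_power_closed[OF K] f)
    ultimately show ?thesis
      unfolding c_def cofactor_def by (intro cl)
  qed
  have "\<delta> l (c j) = 0" if l: "l < m" and j: "j \<le> N" for l j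
  proof -
    \<comment> \<open>Apply \<delta>_l to the relation for \<alpha>. The terms in which \<delta>_l
      hits a derivative of \<open>f j\<close> sum to the relation for the raised index, hence to 0;
      the term \<open>j = N\<close> drops out because \<open>c N = 1\<close>.\<close>
    have shorter: "(\<Sum>j<N. \<delta> l (c j) * der_power m \<delta> \<alpha> (f j)) = 0"
      if \<alpha>: "\<alpha> \<in> multi_indices m" for \<alpha>
    proof -
      have "\<alpha>(l := Suc (\<alpha> l)) \<in> multi_indices m"
        using \<alpha> l by (auto simp: multi_indices_def)
      note rel[OF this]
      moreover have "\<delta> l (\<Sum>j<Suc N. c j * der_power m \<delta> \<alpha> (f j)) =
          (\<Sum>j<Suc N. \<delta> l (c j) * der_power m \<delta> \<alpha> (f j)) +
          (\<Sum>j<Suc N. c j * der_power m \<delta> (\<alpha>(l := Suc (\<alpha> l))) (f j))"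
        using l by (simp only: der_sum der_mult der_der_power sum.distrib)
      ultimately show ?thesis
        using rel[OF \<alpha>] l cN by simp
    qed
    let ?v = "vec N (\<lambda>j. \<delta> l (c j))"
    \<comment> \<open>Taking \<alpha> to be the indices \<open>A i\<close> puts the differentiated
      coefficients into the kernel of \<open>B\<close>.\<close>
    have "B *\<^sub>v ?v = 0\<^sub>v N"
      using shorter A by (intro eq_vecI)
        (simp_all add: B_def scalar_prod_def mult.commute lessThan_atLeast0)
    then have "?v = 0\<^sub>v N"
      using detB det_0_iff_vec_prod_zero[OF B] by (metis vec_carrier)
    then have "\<delta> l (c j) = 0" if "j < N"
      using that by (metis index_vec index_zero_vec(1))
    then show ?thesis
      using j cN l by (cases "j = N") auto
  qed
  moreover have "(\<Sum>j<Suc N. c j * f j) = 0"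
    using rel[of "\<lambda>_. 0"] by (simp add: multi_indices_def der_power_zero)
  ultimately show ?thesis
    using cK cN by (intro exI[of _ c]) (auto simp: constants_def)
qed

text \<open>Induction on \<open>N\<close> replaces the choice of a least length: either the first
  \<open>N\<close> functions already have vanishing Wronskians, or a nonzero one of size
  \<open>N\<close> can be bordered.\<close>

lemma wronskians_eq_0_imp_relation:
  assumes K: "differential_subfield m \<delta> K"
    and "\<And>j. j < N \<Longrightarrow> f j \<in> K"
    and "\<And>A. (\<And>i. i < N \<Longrightarrow> A i \<in> multi_indices m) \<Longrightarrow>
      det (mat N N (\<lambda>(i, j). der_power m \<delta> (A i) (f j))) = 0"
  shows "\<exists>c. (\<forall>j<N. c j \<in> constants m \<delta> K) \<and> (\<exists>j<N. c j \<noteq> 0) \<and> (\<Sum>j<N. c j * f j) = 0"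
  using assms(2,3)
proof (induction N)
  case 0
  \<comment> \<open>The empty determinant is 1, contradicting the vanishing hypothesis.\<close>
  then show ?case by (simp add: det_def')
next
  case (Suc N)
  show ?case
  proof (cases "\<forall>A. (\<forall>i<N. A i \<in> multi_indices m) \<longrightarrow>
      det (mat N N (\<lambda>(i, j). der_power m \<delta> (A i) (f j))) = 0")
    case True
    then have "\<exists>c. (\<forall>j<N. c j \<in> constants m \<delta> K) \<and> (\<exists>j<N. c j \<noteq> 0) \<and> (\<Sum>j<N. c j * f j) = 0"
      using Suc.prems(1) by (intro Suc.IH) simp_all
    then obtain c j where c: "\<And>j. j < N \<Longrightarrow> c j \<in> constants m \<delta> K" "j < N" "c j \<noteq> 0"
      "(\<Sum>j<N. c j * f j) = 0"
      by blast
    have "0 \<in> constants m \<delta> K"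
      using differential_subfield_closed(1)[OF K] by (simp add: constants_def)
    \<comment> \<open>A relation among the first \<open>N\<close> functions is padded with the
      coefficient 0.\<close>
    moreover have "(\<Sum>j<N. (c(N := 0)) j * f j) = 0"
      using c(4) by simp
    ultimately show ?thesis
      using c(1-3) by (intro exI[of _ "c(N := 0)"]) (auto simp: less_Suc_eq intro!: exI[of _ j])
  next
    case False
    then obtain A where "\<And>i. i < N \<Longrightarrow> A i \<in> multi_indices m"
      "det (mat N N (\<lambda>(i, j). der_power m \<delta> (A i) (f j))) \<noteq> 0"
      by blast
    from relation_from_maximal_wronskian[OF K _ this Suc.prems(2)] Suc.prems(1)
    obtain c where "\<forall>j\<le>N. c j \<in> constants m \<delta> K" "c N = 1" "(\<Sum>j<Suc N. c j * f j) = 0"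
      by (auto simp: less_Suc_eq_le)
    then show ?thesis
      by (intro exI[of _ c]) (auto simp: less_Suc_eq_le)
  qed
qed

end

lemma commuting_derivations_universal_domain:
  assumes "universal_domain m \<delta>"
  shows "commuting_derivations m \<delta>"
  using assms
  unfolding universal_domain_def differentially_closed_def differential_field_def
    commuting_derivations_def
  by simp

section \<open>Projective points\<close>

text \<open>Both vectors are nonzero multiples of the vector generating the class, so their ratio of
  scaling factors links them.\<close>

lemma proj_space_cases:
  assumes "p \<in> proj_space n" "v \<in> p" "w \<in> p"
  obtains a where "a \<noteq> 0" "w = a \<cdot>\<^sub>v v" "v \<in> carrier_vec (Suc n)" "v \<noteq> 0\<^sub>v (Suc n)"
proof -
  obtain x where x: "x \<in> carrier_vec (Suc n)" "x \<noteq> 0\<^sub>v (Suc n)" "p = proj_rel n `` {x}"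
    using assms(1) by (auto simp: proj_space_def elim!: quotientE)
  obtain a b where ab: "a \<noteq> 0" "v = a \<cdot>\<^sub>v x" "b \<noteq> 0" "w = b \<cdot>\<^sub>v x"
    using assms(2,3) x(3) by (auto simp: proj_rel_def)
  have "x = inverse a \<cdot>\<^sub>v v"
    using ab by (simp add: smult_smult_assoc)
  then have "v \<noteq> 0\<^sub>v (Suc n)"
    using x(2) by auto
  moreover have "w = (b / a) \<cdot>\<^sub>v v"
    using ab by (simp add: smult_smult_assoc)
  ultimately show thesis
    using that[of "b / a"] ab x(1) by simp
qed

lemma proj_space_smult:
  assumes "p \<in> proj_space n" "v \<in> p" "a \<noteq> 0"
  shows "a \<cdot>\<^sub>v v \<in> p"
proof -
  obtain x where x: "x \<in> carrier_vec (Suc n)" "x \<noteq> 0\<^sub>v (Suc n)" "p = proj_rel n `` {x}"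
    using assms(1) by (auto simp: proj_space_def elim!: quotientE)
  then obtain b where "b \<noteq> 0" "v = b \<cdot>\<^sub>v x"
    using assms(2) by (auto simp: proj_rel_def)
  then show ?thesis
    using x assms(3) by (auto simp: proj_rel_def smult_smult_assoc intro!: exI[of _ "a * b"])
qed

theorem corollary4p15:
  fixes \<delta> :: "nat \<Rightarrow> 'a \<Rightarrow> 'a::field"
    and m n :: nat
    and K k :: "'a set"
    and f :: "nat \<Rightarrow> 'a"
  assumes "universal_domain m \<delta>"
    and "differential_subfield m \<delta> K" and "small K"
    and "differential_subfield m \<delta> k" and "k \<subseteq> K"
    and "\<And>i. i \<le> n \<Longrightarrow> f i \<in> K"
    and "large_wrt m \<delta> k K (proj_points n (constants m \<delta> UNIV))"
  shows "linearly_dependent_over n f (proj_points n (constants m \<delta> k)) \<longleftrightarrow>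
         (\<forall>A. (\<forall>i\<le>n. A i \<in> multi_indices m) \<longrightarrow>
              eval_dpoly m \<delta> f (gen_wronskian n A) = 0)"
proof -
  interpret commuting_derivations m \<delta>
    using assms(1) by (rule commuting_derivations_universal_domain)
  show ?thesis
  proof
    assume "linearly_dependent_over n f (proj_points n (constants m \<delta> k))"
    \<comment> \<open>The representative \<open>c\<close> in the relation and the representative
      \<open>v\<close> over the constants of \<open>k\<close> may differ; they are proportional, so
      the relation passes to \<open>v\<close>.\<close>
    then obtain p c v where p: "p \<in> proj_space n" "c \<in> p" "v \<in> p"
      and v: "\<And>i. i < dim_vec v \<Longrightarrow> v $ i \<in> constants m \<delta> k"
      and c: "(\<Sum>i\<le>n. c $ i * f i) = 0"
      by (auto simp: linearly_dependent_over_def proj_points_def rational_points_def)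
    obtain a where a: "a \<noteq> 0" "c = a \<cdot>\<^sub>v v" "v \<in> carrier_vec (Suc n)" "v \<noteq> 0\<^sub>v (Suc n)"
      using proj_space_cases[OF p(1,3,2)] .
    have "(\<Sum>i\<le>n. c $ i * f i) = a * (\<Sum>i\<le>n. v $ i * f i)"
      unfolding sum_distrib_left by (rule sum.cong) (use a in \<open>auto simp: mult.assoc\<close>)
    with c a(1) have rel: "(\<Sum>i<Suc n. v $ i * f i) = 0"
      by (simp add: lessThan_Suc_atMost)
    obtain j where j: "j < Suc n" "v $ j \<noteq> 0"
      using a(3,4) by (metis carrier_vecD eq_vecI index_zero_vec)
    have "v $ i \<in> constants m \<delta> UNIV" if "i < Suc n" for i
      using v[of i] a(3) that by (auto simp: constants_def)
    from relation_imp_wronskian_eq_0[OF this j rel]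
    show "\<forall>A. (\<forall>i\<le>n. A i \<in> multi_indices m) \<longrightarrow> eval_dpoly m \<delta> f (gen_wronskian n A) = 0"
      by (simp add: eval_gen_wronskian)
  next
    assume "\<forall>A. (\<forall>i\<le>n. A i \<in> multi_indices m) \<longrightarrow> eval_dpoly m \<delta> f (gen_wronskian n A) = 0"
    then obtain c j where c: "\<And>j. j < Suc n \<Longrightarrow> c j \<in> constants m \<delta> K"
      and j: "j < Suc n" "c j \<noteq> 0" and rel: "(\<Sum>j<Suc n. c j * f j) = 0"
      using wronskians_eq_0_imp_relation[OF assms(2), of "Suc n" f] assms(6)
      by (auto simp: eval_gen_wronskian less_Suc_eq_le)
    let ?v = "vec (Suc n) c"
    define p where "p = proj_rel n `` {?v}"
    have "?v \<noteq> 0\<^sub>v (Suc n)"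
      using j by (metis index_vec index_zero_vec(1))
    then have p: "p \<in> proj_space n" and vp: "?v \<in> p"
      unfolding p_def proj_space_def
      by (simp_all add: quotientI) (auto simp: proj_rel_def intro!: exI[of _ "1 :: 'a"])
    have "p \<in> proj_points n (constants m \<delta> UNIV)"
      using p vp c by (auto simp: proj_points_def rational_points_def constants_def intro!: bexI[of _ ?v])
    moreover obtain C where "K \<subseteq> C" and C:
      "rational_points (proj_points n (constants m \<delta> UNIV)) k =
       rational_points (proj_points n (constants m \<delta> UNIV)) C"
      using assms(7) by (auto simp: large_wrt_def differential_closure_def)
    \<comment> \<open>The vector \<open>?v\<close> has entries in \<open>K\<close>, hence in the
      differential closure \<open>C\<close>; largeness turns this rationality over \<open>C\<close>
      into rationality over \<open>k\<close>.\<close>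
    ultimately have "p \<in> rational_points (proj_points n (constants m \<delta> UNIV)) k"
      unfolding C using vp c by (auto simp: rational_points_def constants_def intro!: bexI[of _ ?v])
    then obtain w where w: "w \<in> p" "\<And>i. i < dim_vec w \<Longrightarrow> w $ i \<in> k"
      by (auto simp: rational_points_def)
    obtain a where a: "a \<noteq> 0" "w = a \<cdot>\<^sub>v ?v"
      using proj_space_cases[OF p vp w(1)] .
    \<comment> \<open>The representative \<open>?v\<close> has constant entries and \<open>w\<close>
      has entries in \<open>k\<close>. Normalizing coordinate \<open>j\<close> to 1 gives the same
      vector from both, so its entries are constants and lie in \<open>k\<close>.\<close>
    define u where "u = (1 / c j) \<cdot>\<^sub>v ?v"
    have "u $ i \<in> constants m \<delta> k" if i: "i < Suc n" for i
    proof -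
      have "c i / c j \<in> constants m \<delta> UNIV"
        using c[OF i] c[OF j(1)] by (intro constants_divide) (auto simp: constants_def)
      moreover have "u $ i = c i / c j" "u $ i = w $ i / w $ j"
        using a i j by (simp_all add: u_def)
      moreover have "w $ i / w $ j \<in> k"
        using w(2) a i j by (intro differential_subfield_closed(6)[OF assms(4)]) auto
      ultimately show ?thesis
        by (simp add: constants_def)
    qed
    moreover have "u \<in> p"
      unfolding u_def using j by (intro proj_space_smult[OF p vp]) simp
    ultimately have "p \<in> proj_points n (constants m \<delta> k)"
      using p by (auto simp: proj_points_def rational_points_def u_def intro!: bexI[of _ u])
    \<comment> \<open>Dependence may be witnessed by any representative of \<open>p\<close>, so
      \<open>?v\<close> itself serves.\<close>
    moreover have "(\<Sum>i\<le>n. ?v $ i * f i) = 0"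
      using rel by (simp add: lessThan_Suc_atMost)
    ultimately show "linearly_dependent_over n f (proj_points n (constants m \<delta> k))"
      unfolding linearly_dependent_over_def using vp by blast
  qed
qed

end
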